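(* Let $d\ge2$, let $\psi:[0,\infty)\to(0,1]$ be a strict $d$-monotone Archimedean generator that is continuously differentiable on $(0,\infty)$, and let $\ell_1,\ell_2$ be $d$-variate stable tail dependence functions. Let $C_1,C_2$ be the Archimax copulas $$C_k(u)=\psi\Bigl(\ell_k\bigl(\psi^{-1}(u_1),\dots,\psi^{-1}(u_d)\bigr)\Bigr),\qquad u\in(0,1]^d,\quad k=1,2,$$ and set $K_\psi:=\sup_{t>0}t|\psi'(t)|$. If $K_\psi<\infty$, then $$\mathrm d_K(C_1,C_2)\le K_\psi\sup_{\substack{w\in[0,\infty)^d\\ \max_iw_i=1}}|\ell_1(w)-\ell_2(w)|.$$
   Context: Strict $d$-monotone Archimedean generator: $\psi$ is strictly decreasing with $\psi(0)=1$, $\lim_{t\to\infty}\psi(t)=0$, it is differentiable up to order $d-2$ on $(0,\infty)$ with $(-1)^m\psi^{(m)}(t)\ge0$ for $m=0,\dots,d-2$, and $(-1)^{d-2}\psi^{(d-2)}$ is nonincreasing and convex. Under these assumptions each $C_k$ (extended to $[0,1]^d$ by continuity) is a $d$-dimensional copula. Stable tail dependence function: a function $\ell:[0,\infty)^d\to[0,\infty)$ of the form $\ell(z)=\mathbb{E}\{\max_{1\le j\le d}z_jZ_j\}$ for a random vector $Z$ with values in $[0,\infty)^d$, $\mathbb{E}\{Z_j\}=1$ for all $j$ and $\mathbb{P}\{\max_jZ_j>0\}=1$. For copulas, $\mathrm d_K(C_1,C_2)=\sup_{u\in[0,1]^d}|C_1(u)-C_2(u)|$. *)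

theory Defs
  imports "HOL-Probability.Probability"
begin

text \<open>
  Continuity on \<open>[0,\<infinity>)\<close> is part of the usual notion of an Archimedean generator. Given the other
  clauses it says exactly that \<open>\<psi>\<close> maps \<open>[0,\<infinity>)\<close> onto \<open>(0,1]\<close>, so that the inverse of \<open>\<psi>\<close> is defined
  on all of \<open>(0,1]\<close>. The iterates of \<open>deriv\<close> are only used on \<open>(0,\<infinity>)\<close>.
\<close>

definition strict_monotone_generator :: "nat \<Rightarrow> (real \<Rightarrow> real) \<Rightarrow> bool" where
  "strict_monotone_generator d \<psi> \<longleftrightarrow>
     \<psi> \<in> {0..} \<rightarrow> {0<..1} \<and>
     continuous_on {0..} \<psi> \<and>
     strict_antimono_on {0..} \<psi> \<and>
     \<psi> 0 = 1 \<and>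
     (\<psi> \<longlongrightarrow> 0) at_top \<and>
     (\<forall>m<d - 2. \<forall>t>0. (deriv ^^ m) \<psi> differentiable (at t)) \<and>
     (\<forall>m\<le>d - 2. \<forall>t>0. (-1) ^ m * (deriv ^^ m) \<psi> t \<ge> 0) \<and>
     antimono_on {0<..} (\<lambda>t. (-1) ^ (d - 2) * (deriv ^^ (d - 2)) \<psi> t) \<and>
     convex_on {0<..} (\<lambda>t. (-1) ^ (d - 2) * (deriv ^^ (d - 2)) \<psi> t)"

text \<open>
  The values of \<open>L\<close> outside \<open>[0,\<infinity>)\<^sup>d\<close> are left unconstrained. An
  expectation equal to 1 entails integrability, as the Bochner integral of a non-integrable
  function is 0.
\<close>

definition represents_stdf ::
  "'a measure \<Rightarrow> ('a \<Rightarrow> real ^ 'd) \<Rightarrow> (real ^ 'd \<Rightarrow> real) \<Rightarrow> bool" where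
  "represents_stdf M Z L \<longleftrightarrow>
     prob_space M \<and>
     Z \<in> borel_measurable M \<and>
     (\<forall>\<omega>\<in>space M. \<forall>j. 0 \<le> Z \<omega> $ j) \<and>
     (\<forall>j. (\<integral>\<omega>. Z \<omega> $ j \<partial>M) = 1) \<and>
     measure M {\<omega> \<in> space M. (MAX j. Z \<omega> $ j) > 0} = 1 \<and>
     (\<forall>z. (\<forall>j. 0 \<le> z $ j) \<longrightarrow> L z = (\<integral>\<omega>. (MAX j. z $ j * Z \<omega> $ j) \<partial>M))"

text \<open>
  A type cannot be quantified existentially, so the sample space is taken inside \<open>real ^ 'd\<close>;
  the lemma after the definition shows that random vectors on arbitrary sample spaces give
  nothing more.
\<close>

definition stable_tail_dependence_function :: "(real ^ 'd \<Rightarrow> real) \<Rightarrow> bool" where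
  "stable_tail_dependence_function L \<longleftrightarrow>
     (\<exists>(M :: (real ^ 'd) measure) (Z :: real ^ 'd \<Rightarrow> real ^ 'd). represents_stdf M Z L)"

lemma borel_measurable_MAX_vec [measurable]:
  "(\<lambda>x :: real ^ 'd. MAX j. z $ j * x $ j) \<in> borel_measurable borel"
  "(\<lambda>x :: real ^ 'd. MAX j. x $ j) \<in> borel_measurable borel"
  by (rule borel_measurable_Max; simp)+

lemma stable_tail_dependence_functionI:
  fixes L :: "real ^ 'd \<Rightarrow> real"
  assumes "represents_stdf M Z L"
  shows "stable_tail_dependence_function L"
proof -
  let ?N = "distr M borel Z"
  let ?W = "\<lambda>x :: real ^ 'd. \<chi> j. max 0 (x $ j)"
  have M: "prob_space M" and Z [measurable]: "Z \<in> borel_measurable M"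
    and nn: "\<And>\<omega> j. \<omega> \<in> space M \<Longrightarrow> 0 \<le> Z \<omega> $ j"
    and E: "\<And>j. (\<integral>\<omega>. Z \<omega> $ j \<partial>M) = 1"
    and P: "measure M {\<omega> \<in> space M. (MAX j. Z \<omega> $ j) > 0} = 1"
    and LZ: "\<And>z. (\<forall>j. 0 \<le> z $ j) \<Longrightarrow> L z = (\<integral>\<omega>. (MAX j. z $ j * Z \<omega> $ j) \<partial>M)"
    using assms by (auto simp: represents_stdf_def)
  have "continuous_on UNIV ?W"
    by (intro continuous_intros)
  then have W [measurable]: "?W \<in> borel_measurable borel"
    by (rule borel_measurable_continuous_onI)
  have WZ: "?W (Z \<omega>) = Z \<omega>" if "\<omega> \<in> space M" for \<omega>
    using nn[OF that] by (simp add: vec_eq_iff)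
  have "represents_stdf ?N ?W L"
    unfolding represents_stdf_def
  proof (intro conjI allI ballI impI)
    show "prob_space ?N" using M Z by (rule prob_space.prob_space_distr)
    show "?W \<in> borel_measurable ?N" by simp
    show "0 \<le> ?W \<omega> $ j" for \<omega> j by simp
    show "(\<integral>\<omega>. ?W \<omega> $ j \<partial>?N) = 1" for j
    proof -
      have "(\<integral>\<omega>. ?W \<omega> $ j \<partial>?N) = (\<integral>\<omega>. ?W (Z \<omega>) $ j \<partial>M)"
        by (rule integral_distr) (use W in \<open>auto intro!: measurable_compose[OF W]\<close>)
      also have "\<dots> = (\<integral>\<omega>. Z \<omega> $ j \<partial>M)"
        by (rule Bochner_Integration.integral_cong) (simp_all only: WZ)
      finally show ?thesis using E by simp
    qed
    have meas: "{x. (MAX j. ?W x $ j) > 0} \<in> sets borel"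
      using measurable_compose[OF W borel_measurable_MAX_vec(2)]
      by (simp add: borel_measurable_iff_greater)
    have "measure ?N {x \<in> space ?N. (MAX j. ?W x $ j) > 0}
        = measure M (Z -` {x. (MAX j. ?W x $ j) > 0} \<inter> space M)"
      using measure_distr[OF Z meas] by simp
    also have "Z -` {x. (MAX j. ?W x $ j) > 0} \<inter> space M = {\<omega> \<in> space M. (MAX j. Z \<omega> $ j) > 0}"
      using WZ by (auto simp del: vec_lambda_beta)
    finally show "measure ?N {x \<in> space ?N. (MAX j. ?W x $ j) > 0} = 1" using P by simp
    show "L z = (\<integral>\<omega>. (MAX j. z $ j * ?W \<omega> $ j) \<partial>?N)" if "\<forall>j. 0 \<le> z $ j" for z
    proof -
      have "(\<integral>\<omega>. (MAX j. z $ j * ?W \<omega> $ j) \<partial>?N) = (\<integral>\<omega>. (MAX j. z $ j * ?W (Z \<omega>) $ j) \<partial>M)"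
        by (rule integral_distr[OF Z]) (rule measurable_compose[OF W borel_measurable_MAX_vec(1)])
      also have "\<dots> = (\<integral>\<omega>. (MAX j. z $ j * Z \<omega> $ j) \<partial>M)"
        by (rule Bochner_Integration.integral_cong) (simp_all only: WZ)
      finally show ?thesis using LZ[OF that] by simp
    qed
  qed
  then show ?thesis
    unfolding stable_tail_dependence_function_def by blast
qed

definition archimax_formula ::
  "(real \<Rightarrow> real) \<Rightarrow> (real ^ 'd \<Rightarrow> real) \<Rightarrow> real ^ 'd \<Rightarrow> real" where
  "archimax_formula \<psi> L u = \<psi> (L (\<chi> j. inv_into {0..} \<psi> (u $ j)))"

text \<open>The formula on \<open>(0,1]\<^sup>d\<close>, extended by continuity to \<open>[0,1]\<^sup>d\<close>; junk elsewhere.\<close>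

definition archimax_copula ::
  "(real \<Rightarrow> real) \<Rightarrow> (real ^ 'd \<Rightarrow> real) \<Rightarrow> real ^ 'd \<Rightarrow> real" where
  "archimax_copula \<psi> L u =
     (let S = {v. \<forall>j. v $ j \<in> {0<..1}} in
      if u \<in> S then archimax_formula \<psi> L u
      else Lim (at u within S) (archimax_formula \<psi> L))"

definition d_K :: "(real ^ 'd \<Rightarrow> real) \<Rightarrow> (real ^ 'd \<Rightarrow> real) \<Rightarrow> real" where
  "d_K C\<^sub>1 C\<^sub>2 = (SUP u \<in> {u. \<forall>j. u $ j \<in> {0..1}}. \<bar>C\<^sub>1 u - C\<^sub>2 u\<bar>)"

end

theory Submission
  imports Defs
begin

text \<open>
  Let \<open>x\<^sub>j = \<psi>\<^sup>-\<^sup>1(u\<^sub>j)\<close> and \<open>m = max\<^sub>j x\<^sub>j\<close>, where \<open>m > 0\<close> unless \<open>u = (1,\<dots>,1)\<close>, in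
  which case both copulas equal 1. A stable tail dependence function is homogeneous of
  degree one and dominates the maximum, because \<open>E (max\<^sub>j z\<^sub>j Z\<^sub>j) \<ge> z\<^sub>j E Z\<^sub>j = z\<^sub>j\<close>. So both
  \<open>L\<^sub>1 x\<close> and \<open>L\<^sub>2 x\<close> lie in \<open>[m,\<infinity>)\<close>, where \<open>\<bar>\<psi>'\<bar> \<le> K\<^sub>\<psi> / m\<close>, and the mean value theorem gives
  \<open>\<bar>\<psi> (L\<^sub>1 x) - \<psi> (L\<^sub>2 x)\<bar> \<le> (K\<^sub>\<psi> / m) \<bar>L\<^sub>1 x - L\<^sub>2 x\<bar> = K\<^sub>\<psi> \<bar>L\<^sub>1 (x/m) - L\<^sub>2 (x/m)\<bar>\<close>,
  with \<open>x/m\<close> of maximum 1 (lemma \<open>generator_stdf_diff_le\<close>).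

  If some \<open>u\<^sub>j\<close> vanishes, both copulas vanish at \<open>u\<close>: on \<open>(0,1]\<^sup>d\<close> the Archimax formula takes
  values between 0 and \<open>u\<^sub>j\<close>, again because \<open>L x \<ge> x\<^sub>j\<close>, so its limit there is 0
  (lemma \<open>archimax_copula_eq_0\<close>).
\<close>

section \<open>Stable tail dependence functions\<close>

lemma represents_stdf_integrable:
  fixes Z :: "'a \<Rightarrow> real ^ 'd"
  assumes "represents_stdf M Z L" and z: "\<And>j. 0 \<le> z $ j"
  shows "integrable M (\<lambda>\<omega>. Z \<omega> $ j)"
    and "integrable M (\<lambda>\<omega>. MAX j. z $ j * Z \<omega> $ j)"
proof -
  have Z: "Z \<in> borel_measurable M"
    and nn: "\<And>\<omega> j. \<omega> \<in> space M \<Longrightarrow> 0 \<le> Z \<omega> $ j"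
    and E: "\<And>j. (\<integral>\<omega>. Z \<omega> $ j \<partial>M) = 1"
    using assms(1) by (auto simp: represents_stdf_def)
  \<comment> \<open>The Bochner integral of a non-integrable function is 0, not 1.\<close>
  have int: "integrable M (\<lambda>\<omega>. Z \<omega> $ j)" for j
    using E[of j] not_integrable_integral_eq[of M "\<lambda>\<omega>. Z \<omega> $ j"] by fastforce
  then show "integrable M (\<lambda>\<omega>. Z \<omega> $ j)" .
  show "integrable M (\<lambda>\<omega>. MAX j. z $ j * Z \<omega> $ j)"
  proof (rule Bochner_Integration.integrable_bound)
    show "integrable M (\<lambda>\<omega>. \<Sum>j\<in>UNIV. z $ j * Z \<omega> $ j)"
      using int by (intro Bochner_Integration.integrable_sum integrable_mult_right)
    show "(\<lambda>\<omega>. MAX j. z $ j * Z \<omega> $ j) \<in> borel_measurable M"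
      by (rule measurable_compose[OF Z borel_measurable_MAX_vec(1)])
    show "AE \<omega> in M. norm (MAX j. z $ j * Z \<omega> $ j) \<le> norm (\<Sum>j\<in>UNIV. z $ j * Z \<omega> $ j)"
    proof (rule AE_I2)
      fix \<omega> assume \<omega>: "\<omega> \<in> space M"
      have pos: "0 \<le> z $ j * Z \<omega> $ j" for j using z nn[OF \<omega>] by simp
      have "0 \<le> (MAX j. z $ j * Z \<omega> $ j)"
        using pos by (subst Max_ge_iff) auto
      moreover have "(MAX j. z $ j * Z \<omega> $ j) \<le> (\<Sum>j\<in>UNIV. z $ j * Z \<omega> $ j)"
        using pos by (auto intro: member_le_sum)
      ultimately show "norm (MAX j. z $ j * Z \<omega> $ j) \<le> norm (\<Sum>j\<in>UNIV. z $ j * Z \<omega> $ j)"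
        unfolding real_norm_def by linarith
    qed
  qed
qed

lemma stdf_ge_component:
  fixes L :: "real ^ 'd \<Rightarrow> real"
  assumes "stable_tail_dependence_function L" and z: "\<And>j. 0 \<le> z $ j"
  shows "z $ i \<le> L z"
proof -
  obtain M and Z :: "real ^ 'd \<Rightarrow> real ^ 'd" where rep: "represents_stdf M Z L"
    using assms(1) unfolding stable_tail_dependence_function_def by blast
  have "z $ i = (\<integral>\<omega>. z $ i * Z \<omega> $ i \<partial>M)"
    using rep by (simp add: represents_stdf_def)
  also have "\<dots> \<le> (\<integral>\<omega>. (MAX j. z $ j * Z \<omega> $ j) \<partial>M)"
    by (intro integral_mono integrable_mult_right represents_stdf_integrable[OF rep z])
       (auto intro: Max_ge)
  also have "\<dots> = L z"
    using rep z by (simp add: represents_stdf_def)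
  finally show ?thesis .
qed

lemma stdf_le_sum:
  fixes L :: "real ^ 'd \<Rightarrow> real"
  assumes "stable_tail_dependence_function L" and z: "\<And>j. 0 \<le> z $ j"
  shows "L z \<le> (\<Sum>j\<in>UNIV. z $ j)"
proof -
  obtain M and Z :: "real ^ 'd \<Rightarrow> real ^ 'd" where rep: "represents_stdf M Z L"
    using assms(1) unfolding stable_tail_dependence_function_def by blast
  have nn: "\<And>\<omega> j. \<omega> \<in> space M \<Longrightarrow> 0 \<le> Z \<omega> $ j"
    using rep by (auto simp: represents_stdf_def)
  have "L z = (\<integral>\<omega>. (MAX j. z $ j * Z \<omega> $ j) \<partial>M)"
    using rep z by (simp add: represents_stdf_def)
  also have "\<dots> \<le> (\<integral>\<omega>. (\<Sum>j\<in>UNIV. z $ j * Z \<omega> $ j) \<partial>M)"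
    using z nn
    by (intro integral_mono Bochner_Integration.integrable_sum integrable_mult_right
          represents_stdf_integrable[OF rep z])
       (auto intro!: member_le_sum)
  also have "\<dots> = (\<Sum>j\<in>UNIV. \<integral>\<omega>. z $ j * Z \<omega> $ j \<partial>M)"
    by (intro Bochner_Integration.integral_sum integrable_mult_right
          represents_stdf_integrable[OF rep z])
  also have "\<dots> = (\<Sum>j\<in>UNIV. z $ j)"
    using rep by (simp add: represents_stdf_def)
  finally show ?thesis .
qed

lemma stdf_scaleR:
  fixes L :: "real ^ 'd \<Rightarrow> real"
  assumes "stable_tail_dependence_function L" and z: "\<And>j. 0 \<le> z $ j" and c: "0 \<le> c"
  shows "L (c *\<^sub>R z) = c * L z"
proof -
  obtain M and Z :: "real ^ 'd \<Rightarrow> real ^ 'd" where rep: "represents_stdf M Z L"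
    using assms(1) unfolding stable_tail_dependence_function_def by blast
  have "(MAX j. (c *\<^sub>R z) $ j * Z \<omega> $ j) = c * (MAX j. z $ j * Z \<omega> $ j)" for \<omega>
  proof -
    have "mono (\<lambda>x. c * x)" using c by (simp add: mono_def mult_left_mono)
    from mono_Max_commute[OF this, of "range (\<lambda>j. z $ j * Z \<omega> $ j)"]
    show ?thesis by (simp add: image_image mult.assoc)
  qed
  then show ?thesis
    using rep z c by (simp add: represents_stdf_def)
qed

lemma bdd_above_stdf_diff:
  assumes L\<^sub>1: "stable_tail_dependence_function L\<^sub>1" and L\<^sub>2: "stable_tail_dependence_function L\<^sub>2"
  shows "bdd_above ((\<lambda>w. \<bar>L\<^sub>1 w - L\<^sub>2 w\<bar>) ` {w :: real ^ 'd. (\<forall>i. 0 \<le> w $ i) \<and> (MAX i. w $ i) = 1})"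
proof (rule bdd_aboveI2)
  fix w :: "real ^ 'd"
  assume "w \<in> {w. (\<forall>i. 0 \<le> w $ i) \<and> (MAX i. w $ i) = 1}"
  then have w: "\<And>i. 0 \<le> w $ i" and "(MAX i. w $ i) = 1" by auto
  then have "w $ i \<le> 1" for i by (metis Max_ge finite finite_imageI rangeI)
  then have "(\<Sum>j\<in>UNIV. w $ j) \<le> real CARD('d)"
    using sum_bounded_above[of UNIV "\<lambda>j. w $ j" 1] by simp
  moreover have "0 \<le> L\<^sub>1 w" "0 \<le> L\<^sub>2 w"
    using stdf_ge_component[OF L\<^sub>1 w] stdf_ge_component[OF L\<^sub>2 w] w order_trans by blast+
  ultimately show "\<bar>L\<^sub>1 w - L\<^sub>2 w\<bar> \<le> real CARD('d)"
    using stdf_le_sum[OF L\<^sub>1 w] stdf_le_sum[OF L\<^sub>2 w] by linarith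
qed

section \<open>The estimate on the open part of the cube\<close>

lemma abs_diff_le_of_weighted_deriv:
  fixes \<psi> :: "real \<Rightarrow> real"
  assumes der: "\<And>t. t > 0 \<Longrightarrow> (\<psi> has_real_derivative deriv \<psi> t) (at t)"
    and K: "\<And>t. t > 0 \<Longrightarrow> t * \<bar>deriv \<psi> t\<bar> \<le> K"
    and "0 < m" "m \<le> a" "m \<le> b"
  shows "\<bar>\<psi> a - \<psi> b\<bar> \<le> K / m * \<bar>a - b\<bar>"
proof -
  have "norm (\<psi> a - \<psi> b) \<le> K / m * norm (a - b)"
  proof (rule field_differentiable_bound[of "{m..}"])
    fix t assume "t \<in> {m..}"
    then have t: "m \<le> t" by simp
    show "(\<psi> has_field_derivative deriv \<psi> t) (at t within {m..})"
      using der[of t] t \<open>0 < m\<close> by (auto intro: has_field_derivative_at_within)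
    have "m * \<bar>deriv \<psi> t\<bar> \<le> t * \<bar>deriv \<psi> t\<bar>" using t by (intro mult_right_mono) auto
    also have "\<dots> \<le> K" using K t \<open>0 < m\<close> by simp
    finally show "norm (deriv \<psi> t) \<le> K / m" using \<open>0 < m\<close> by (simp add: field_simps)
  qed (use assms in auto)
  then show ?thesis by simp
qed

lemma generator_stdf_diff_le:
  fixes \<psi> :: "real \<Rightarrow> real" and x :: "real ^ 'd"
  assumes der: "\<And>t. t > 0 \<Longrightarrow> (\<psi> has_real_derivative deriv \<psi> t) (at t)"
    and K: "\<And>t. t > 0 \<Longrightarrow> t * \<bar>deriv \<psi> t\<bar> \<le> K"
    and L\<^sub>1: "stable_tail_dependence_function L\<^sub>1" and L\<^sub>2: "stable_tail_dependence_function L\<^sub>2"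
    and x: "\<And>j. 0 \<le> x $ j"
  shows "\<bar>\<psi> (L\<^sub>1 x) - \<psi> (L\<^sub>2 x)\<bar>
    \<le> K * (SUP w \<in> {w. (\<forall>i. 0 \<le> w $ i) \<and> (MAX i. w $ i) = 1}. \<bar>L\<^sub>1 w - L\<^sub>2 w\<bar>)"
    (is "_ \<le> K * (SUP w \<in> ?W. _)")
proof -
  have "0 \<le> K" using K[of 1] by (simp add: order_trans[OF abs_ge_zero])
  note bdd = bdd_above_stdf_diff[OF L\<^sub>1 L\<^sub>2]
  define m where "m = (MAX j. x $ j)"
  have le_m: "x $ j \<le> m" for j unfolding m_def by simp
  have "m \<in> range (($) x)" unfolding m_def by (intro Max_in) auto
  then obtain i where i: "x $ i = m" by auto
  show ?thesis
  proof (cases "m = 0")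
    case True
    \<comment> \<open>Then \<open>x = 0\<close>, and the left-hand side vanishes; the point with all coordinates 1 shows the
      supremum to be nonnegative.\<close>
    have "x = 0" using True le_m x by (auto simp: vec_eq_iff intro: antisym)
    then have "L\<^sub>1 x = 0" "L\<^sub>2 x = 0"
      using stdf_scaleR[OF L\<^sub>1 x, of 0] stdf_scaleR[OF L\<^sub>2 x, of 0] by auto
    moreover have "0 \<le> (SUP w \<in> ?W. \<bar>L\<^sub>1 w - L\<^sub>2 w\<bar>)"
      by (rule cSUP_upper2[OF bdd, of "\<chi> _. 1"]) auto
    ultimately show ?thesis using \<open>0 \<le> K\<close> by simp
  next
    case False
    with i x[of i] have m: "0 < m" by simp
    define w where "w = (1 / m) *\<^sub>R x"
    have w: "0 \<le> w $ j" for j using x m by (simp add: w_def)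
    have xw: "x = m *\<^sub>R w" using m by (simp add: w_def)
    have "(MAX j. w $ j) = 1"
    proof (rule Max_eqI)
      show "1 \<in> range (($) w)" using i m by (auto simp: w_def intro!: image_eqI[of _ _ i])
    qed (use le_m m in \<open>auto simp: w_def\<close>)
    with w have "w \<in> ?W" by simp
    have "\<bar>\<psi> (L\<^sub>1 x) - \<psi> (L\<^sub>2 x)\<bar> \<le> K / m * \<bar>L\<^sub>1 x - L\<^sub>2 x\<bar>"
      using stdf_ge_component[OF L\<^sub>1 x, of i] stdf_ge_component[OF L\<^sub>2 x, of i] i m
      by (intro abs_diff_le_of_weighted_deriv[OF der K]) auto
    also have "\<bar>L\<^sub>1 x - L\<^sub>2 x\<bar> = m * \<bar>L\<^sub>1 w - L\<^sub>2 w\<bar>"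
      using m stdf_scaleR[OF L\<^sub>1 w, of m] stdf_scaleR[OF L\<^sub>2 w, of m]
      by (simp add: xw abs_mult flip: right_diff_distrib)
    also have "K / m * (m * \<bar>L\<^sub>1 w - L\<^sub>2 w\<bar>) = K * \<bar>L\<^sub>1 w - L\<^sub>2 w\<bar>" using m by simp
    also have "\<dots> \<le> K * (SUP w \<in> ?W. \<bar>L\<^sub>1 w - L\<^sub>2 w\<bar>)"
      using \<open>0 \<le> K\<close> \<open>w \<in> ?W\<close> by (intro mult_left_mono cSUP_upper bdd) auto
    finally show ?thesis .
  qed
qed

section \<open>Archimax copulas on the boundary of the cube\<close>

lemma strict_monotone_generator_inv:
  assumes gen: "strict_monotone_generator d \<psi>" and u: "0 < u" "u \<le> 1"
  shows "0 \<le> inv_into {0..} \<psi> u" and "\<psi> (inv_into {0..} \<psi> u) = u"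
proof -
  have cont: "continuous_on {0..} \<psi>" and "\<psi> 0 = 1" and lim: "(\<psi> \<longlongrightarrow> 0) at_top"
    using gen by (auto simp: strict_monotone_generator_def)
  have "eventually (\<lambda>t. \<psi> t < u \<and> 0 \<le> t) at_top"
    using order_tendstoD(2)[OF lim \<open>0 < u\<close>] eventually_ge_at_top[of 0]
    by (rule eventually_conj)
  then obtain b where "\<psi> b < u" "0 \<le> b"
    using eventually_happens[of _ "at_top :: real filter"] by auto
  then obtain t where "0 \<le> t" "\<psi> t = u"
    using IVT2'[of \<psi> b u 0] continuous_on_subset[OF cont, of "{0..b}"] u \<open>\<psi> 0 = 1\<close> by auto
  then have "u \<in> \<psi> ` {0..}" by auto
  then show "0 \<le> inv_into {0..} \<psi> u" "\<psi> (inv_into {0..} \<psi> u) = u"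
    using inv_into_into[of u \<psi> "{0..}"] f_inv_into_f[of u \<psi> "{0..}"] by auto
qed

lemma archimax_formula_bounds:
  fixes L :: "real ^ 'd \<Rightarrow> real"
  assumes gen: "strict_monotone_generator d \<psi>" and L: "stable_tail_dependence_function L"
    and v: "\<And>j. 0 < v $ j \<and> v $ j \<le> 1"
  shows "0 \<le> archimax_formula \<psi> L v" and "archimax_formula \<psi> L v \<le> v $ i"
proof -
  define x :: "real ^ 'd" where "x = (\<chi> j. inv_into {0..} \<psi> (v $ j))"
  have x: "0 \<le> x $ j" and \<psi>x: "\<psi> (x $ j) = v $ j" for j
    using strict_monotone_generator_inv[OF gen] v by (auto simp: x_def)
  have le: "x $ i \<le> L x" by (rule stdf_ge_component[OF L x])
  have formula: "archimax_formula \<psi> L v = \<psi> (L x)" by (simp add: archimax_formula_def x_def)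
  have "\<psi> \<in> {0..} \<rightarrow> {0<..1}" and anti: "strict_antimono_on {0..} \<psi>"
    using gen by (auto simp: strict_monotone_generator_def)
  then show "0 \<le> archimax_formula \<psi> L v"
    using le x[of i] funcset_mem[of \<psi> "{0..}" "{0<..1}" "L x"] unfolding formula by simp
  have "\<psi> (L x) \<le> \<psi> (x $ i)"
    using le x[of i] anti by (cases "L x = x $ i") (auto simp: monotone_on_def less_imp_le)
  then show "archimax_formula \<psi> L v \<le> v $ i" by (simp add: formula \<psi>x)
qed

text \<open>
  \<open>Lim\<close> returns an arbitrary value along the trivial filter, so the limit of the formula
  determines the copula at \<open>u\<close> only once \<open>u\<close> is known to be an accumulation point of
  \<open>(0,1]\<^sup>d\<close>.
\<close>

lemma cube_accumulation:
  fixes u :: "real ^ 'd"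
  assumes u: "\<And>j. 0 \<le> u $ j \<and> u $ j \<le> 1" and i: "u $ i = 0"
  shows "at u within {v. \<forall>j. v $ j \<in> {0<..1}} \<noteq> bot"
proof -
  let ?S = "{v :: real ^ 'd. \<forall>j. v $ j \<in> {0<..1}}"
  \<comment> \<open>The segment from \<open>u\<close> to the corner with all coordinates 1 lies in
    \<open>(0,1]\<^sup>d\<close> except for its end \<open>u\<close>.\<close>
  let ?g = "\<lambda>t :: real. u + t *\<^sub>R ((\<chi> j. 1) - u)"
  have "(?g \<longlongrightarrow> u + 0 *\<^sub>R ((\<chi> j. 1) - u)) (at_right 0)"
    by (intro tendsto_intros)
  then have "(?g \<longlongrightarrow> u) (at_right 0)" by simp
  moreover have "eventually (\<lambda>t. ?g t \<in> ?S \<and> ?g t \<noteq> u) (at_right 0)"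
    unfolding eventually_at_right_field
  proof (intro exI[of _ 1] conjI allI impI)
    fix t :: real assume t: "0 < t" "t < 1"
    have "0 < u $ j + t * (1 - u $ j)" "u $ j + t * (1 - u $ j) \<le> 1" for j
    proof -
      have "u $ j + t * (1 - u $ j) = (1 - t) * u $ j + t" by (simp add: algebra_simps)
      moreover have "0 \<le> (1 - t) * u $ j" using t u by simp
      moreover have "(1 - t) * u $ j \<le> 1 - t" using t u by (simp add: mult_left_le)
      ultimately show "0 < u $ j + t * (1 - u $ j)" "u $ j + t * (1 - u $ j) \<le> 1"
        using t by linarith+
    qed
    then show "?g t \<in> ?S" by simp
    show "?g t \<noteq> u" using t i by (auto simp: vec_eq_iff intro!: exI[of _ i])
  qed simp
  ultimately have "filterlim ?g (at u within ?S) (at_right 0)"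
    unfolding filterlim_at by (auto elim: eventually_mono)
  then have le: "filtermap ?g (at_right 0) \<le> at u within ?S" by (simp add: filterlim_def)
  show ?thesis
  proof
    assume "at u within ?S = bot"
    with le have "filtermap ?g (at_right 0) = bot" by (simp add: bot_unique)
    then show False by (simp add: filtermap_bot_iff)
  qed
qed

lemma archimax_copula_eq_0:
  fixes L :: "real ^ 'd \<Rightarrow> real"
  assumes gen: "strict_monotone_generator d \<psi>" and L: "stable_tail_dependence_function L"
    and u: "\<And>j. 0 \<le> u $ j \<and> u $ j \<le> 1" and i: "u $ i = 0"
  shows "archimax_copula \<psi> L u = 0"
proof -
  let ?S = "{v :: real ^ 'd. \<forall>j. v $ j \<in> {0<..1}}"
  have "(archimax_formula \<psi> L \<longlongrightarrow> 0) (at u within ?S)"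
  proof (rule tendsto_sandwich)
    show "eventually (\<lambda>v. 0 \<le> archimax_formula \<psi> L v) (at u within ?S)"
      using archimax_formula_bounds(1)[OF gen L] by (auto simp: eventually_at_filter)
    show "eventually (\<lambda>v. archimax_formula \<psi> L v \<le> v $ i) (at u within ?S)"
      using archimax_formula_bounds(2)[OF gen L] by (auto simp: eventually_at_filter)
    show "((\<lambda>v. v $ i) \<longlongrightarrow> 0) (at u within ?S)"
      using tendsto_vec_nth[OF tendsto_ident_at[of u ?S], of i] i by simp
  qed simp
  then have "Lim (at u within ?S) (archimax_formula \<psi> L) = 0"
    by (rule tendsto_Lim[OF cube_accumulation[OF u i]])
  moreover have "u \<notin> ?S" using i by (auto intro!: exI[of _ i])
  ultimately show ?thesis unfolding archimax_copula_def Let_def by (simp only: if_False)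
qed

section \<open>The Kolmogorov distance\<close>

theorem mainTheorem6:
  fixes \<psi> :: "real \<Rightarrow> real" and L\<^sub>1 L\<^sub>2 :: "real ^ 'd \<Rightarrow> real"
  assumes "2 \<le> CARD('d)"
    and "strict_monotone_generator CARD('d) \<psi>"
    and "\<psi> C1_differentiable_on {0<..}"
    and "stable_tail_dependence_function L\<^sub>1"
    and "stable_tail_dependence_function L\<^sub>2"
    and "bdd_above ((\<lambda>t. t * \<bar>deriv \<psi> t\<bar>) ` {0<..})"
  shows "d_K (archimax_copula \<psi> L\<^sub>1) (archimax_copula \<psi> L\<^sub>2)
    \<le> (SUP t \<in> {0<..}. t * \<bar>deriv \<psi> t\<bar>) *
      (SUP w \<in> {w. (\<forall>i. 0 \<le> w $ i) \<and> (MAX i. w $ i) = 1}. \<bar>L\<^sub>1 w - L\<^sub>2 w\<bar>)"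
    (is "_ \<le> ?K * ?D")
proof -
  note gen = assms(2) and L\<^sub>1 = assms(4) and L\<^sub>2 = assms(5)
  have der: "(\<psi> has_real_derivative deriv \<psi> t) (at t)" if "t > 0" for t
    using assms(3) that
    by (auto simp: C1_differentiable_on_def has_real_derivative_iff_has_vector_derivative[symmetric]
        dest!: bspec[of _ _ t] simp: DERIV_imp_deriv)
  have K: "t * \<bar>deriv \<psi> t\<bar> \<le> ?K" if "t > 0" for t
    using assms(6) that by (intro cSUP_upper) auto
  have bound: "\<bar>\<psi> (L\<^sub>1 x) - \<psi> (L\<^sub>2 x)\<bar> \<le> ?K * ?D" if "\<And>j. 0 \<le> x $ j" for x :: "real ^ 'd"
    by (rule generator_stdf_diff_le[OF der K L\<^sub>1 L\<^sub>2 that])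
  have "\<bar>archimax_copula \<psi> L\<^sub>1 u - archimax_copula \<psi> L\<^sub>2 u\<bar> \<le> ?K * ?D"
    if "\<And>j. 0 \<le> u $ j \<and> u $ j \<le> 1" for u :: "real ^ 'd"
  proof (cases "\<exists>i. u $ i = 0")
    case True
    then obtain i where "u $ i = 0" by blast
    then have "archimax_copula \<psi> L\<^sub>1 u = 0" "archimax_copula \<psi> L\<^sub>2 u = 0"
      using archimax_copula_eq_0[OF gen] L\<^sub>1 L\<^sub>2 that by blast+
    moreover have "0 \<le> ?K * ?D" using order_trans[OF abs_ge_zero bound[of 0]] by simp
    ultimately show ?thesis by simp
  next
    case False
    then have u: "0 < u $ j \<and> u $ j \<le> 1" for j using that[of j] by (auto simp: less_le)
    then have "archimax_copula \<psi> L u = \<psi> (L (\<chi> j. inv_into {0..} \<psi> (u $ j)))" for L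
      by (simp add: archimax_copula_def archimax_formula_def)
    then show ?thesis
      using bound[of "\<chi> j. inv_into {0..} \<psi> (u $ j)"] strict_monotone_generator_inv(1)[OF gen] u
      by simp
  qed
  moreover have "{u :: real ^ 'd. \<forall>j. u $ j \<in> {0..1}} \<noteq> {}"
    by (auto intro: exI[of _ 0])
  ultimately show ?thesis
    unfolding d_K_def by (intro cSUP_least) auto
qed

end
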